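(* Let $\beta$ be a fixed inverse temperature, and put $q=e^{-\beta\hbar\omega}$. Consider a qutrit system with Hamiltonian $H_S=\sum_{m=0}^{2} m\hbar\omega\,|m\rangle\langle m|$, initially in the state $|\psi_0\rangle=\frac{1}{\sqrt2}(|0\rangle+|1\rangle)$, and a heat bath at inverse temperature $\beta$. Let $\rho_0=|\psi_0\rangle\langle\psi_0|$ and, in the basis $|0\rangle,|1\rangle,|2\rangle$, let $$\rho=\frac12\begin{pmatrix}1-e^{-2\beta\hbar\omega} & \sqrt{1-e^{-2\beta\hbar\omega}} & 0\\ \sqrt{1-e^{-2\beta\hbar\omega}} & 1 & 0\\ 0&0&e^{-2\beta\hbar\omega}\end{pmatrix}.$$ Then: (1) The state conversion $\rho_0\to\rho$ is realizable by an enhanced thermal operation. (2) If the temperature is such that $0\ll e^{-\beta\hbar\omega}\ll\frac{\sqrt5-1}{2}$ (equivalently, $q\gg0$ and $1-q-q^2\gg0$), then any state $\rho'$ satisfying $|\rho'-\rho|\le\epsilon$, with $\epsilon$ small, is not achievable from $\rho_0$ by a thermal operation, where the heat bath is large in the sense of assumptions (i)–(iii) of the context.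
   Context: A heat bath $R$ has Hamiltonian $H_R=\sum_{E_R}E_R\Pi_{E_R}$, with $E_R$ its energy eigenvalues, $\Pi_{E_R}$ the projectors onto the corresponding eigenspaces, and $g(E_R)$ the degeneracy of $E_R$; its Gibbs state is $\gamma_R=e^{-\beta H_R}/\mathrm{Tr}(e^{-\beta H_R})$. The degeneracy is assumed to be monotonically non-decreasing in $E_R$. The heat bath is assumed large and to satisfy, with $\delta$ small: (i) there is a set of energy levels $\mathcal R$ such that $\sum_{E_R\in\mathcal R}\mathrm{Tr}(\gamma_R\Pi_{E_R})=1-\delta$; (ii) for any $E_R\in\mathcal R$, $E_R\pm m\hbar\omega\in\mathcal R$ for $m=1,2$; (iii) for $E_R\in\mathcal R$, $\left|\frac{g(E_R-m\hbar\omega)}{g(E_R)\,q^m}-1\right|\le\delta$ for $m=1,2$. A thermal operation (TO) on the system $S$ is a map $\mathcal{E}^{\rm TO}(\rho_S)=\mathrm{Tr}_R[U(\rho_S\otimes\gamma_R)U^\dagger]$, where $U$ is a joint unitary commuting with the total Hamiltonian, $[U,H_S+H_R]=0$. An enhanced thermal operation (EnTO) on $S$ is a quantum operation (completely positive trace-preserving map) $\mathcal{E}$ satisfying time-translation symmetry, $\mathcal{E}(e^{-iH_St}\rho_Se^{iH_St})=e^{-iH_St}\mathcal{E}(\rho_S)e^{iH_St}$, and Gibbs preservation, $\mathcal{E}(\gamma_S)=\gamma_S$, where $\gamma_S=e^{-\beta H_S}/\mathrm{Tr}(e^{-\beta H_S})$ is the Gibbs state of the system. $|\rho'-\rho|$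 denotes the distance between the two states (no particular norm is fixed). The notations $\ll$, $\gg$ and "small" are used informally: $0\ll q\ll\frac{\sqrt5-1}{2}$ means that neither $q$ nor $1-q-q^2$ is small. *)

theory Defs
  imports "HOL-Analysis.Analysis"
begin

text \<open>
  Operators on the Hilbert space of square-summable families over an index set A are given by
  their matrix elements in the standard basis; only the entries with both indices in A matter.
  A may be infinite. The definitions below are applied to positive trace-class operators and to
  unitaries, for which all the sums converge absolutely. For unbounded diagonal operators
  (Hamiltonians) the sums have a single nonzero term.
\<close>

type_synonym 'a op = "'a \<Rightarrow> 'a \<Rightarrow> complex"

definition op_mult :: "'a set \<Rightarrow> 'a op \<Rightarrow> 'a op \<Rightarrow> 'a op" where
  "op_mult A X Y = (\<lambda>x y. \<Sum>\<^sub>\<infinity>z\<in>A. X x z * Y z y)"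

definition op_adj :: "'a op \<Rightarrow> 'a op" where
  "op_adj X = (\<lambda>x y. cnj (X y x))"

definition op_diag :: "('a \<Rightarrow> complex) \<Rightarrow> 'a op" where
  "op_diag f = (\<lambda>x y. if x = y then f x else 0)"

definition op_id :: "'a op" where
  "op_id = op_diag (\<lambda>_. 1)"

definition op_add :: "'a op \<Rightarrow> 'a op \<Rightarrow> 'a op" where
  "op_add X Y = (\<lambda>x y. X x y + Y x y)"

definition op_trace :: "'a set \<Rightarrow> 'a op \<Rightarrow> complex" where
  "op_trace A X = (\<Sum>\<^sub>\<infinity>x\<in>A. X x x)"

definition op_tensor :: "'a op \<Rightarrow> 'b op \<Rightarrow> ('a \<times> 'b) op" where
  "op_tensor X Y = (\<lambda>(a, i) (b, j). X a b * Y i j)"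

definition op_eq_on :: "'a set \<Rightarrow> 'a op \<Rightarrow> 'a op \<Rightarrow> bool" where
  "op_eq_on A X Y \<longleftrightarrow> (\<forall>x\<in>A. \<forall>y\<in>A. X x y = Y x y)"

definition op_unitary :: "'a set \<Rightarrow> 'a op \<Rightarrow> bool" where
  "op_unitary A U \<longleftrightarrow>
     op_eq_on A (op_mult A (op_adj U) U) op_id \<and> op_eq_on A (op_mult A U (op_adj U)) op_id"

definition op_commute :: "'a set \<Rightarrow> 'a op \<Rightarrow> 'a op \<Rightarrow> bool" where
  "op_commute A X Y \<longleftrightarrow> op_eq_on A (op_mult A X Y) (op_mult A Y X)"

definition op_psd :: "'a set \<Rightarrow> 'a op \<Rightarrow> bool" where
  "op_psd A X \<longleftrightarrow> (\<forall>v. (\<Sum>x\<in>A. \<Sum>y\<in>A. cnj (v x) * X x y * v y) \<in> \<real>\<^sub>\<ge>\<^sub>0)"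
  \<comment> \<open>used for finite A only\<close>

definition op_of_mat :: "complex^'n^'n \<Rightarrow> 'n op" where
  "op_of_mat M = (\<lambda>m n. M $ m $ n)"


text \<open>
  The system has a finite-dimensional Hilbert space with a basis of energy eigenvectors, and h
  lists the energies, so its Hamiltonian is diagonal and exponentials of it are exponentials of
  the diagonal entries.
\<close>

definition exp_ham :: "complex \<Rightarrow> real^'n \<Rightarrow> complex^'n^'n" where
  "exp_ham z h = (\<chi> m n. if m = n then exp (z * complex_of_real (h $ m)) else 0)"

definition gibbs_sys :: "real \<Rightarrow> real^'n \<Rightarrow> complex^'n^'n" where
  "gibbs_sys \<beta> h = (let W = exp_ham (- complex_of_real \<beta>) h in \<chi> m n. W $ m $ n / trace W)"

definition density_matrix :: "complex^'n^'n \<Rightarrow> bool" where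
  "density_matrix \<rho> \<longleftrightarrow> op_psd UNIV (op_of_mat \<rho>) \<and> trace \<rho> = 1"

definition pure_state :: "complex^'n \<Rightarrow> complex^'n^'n" where
  "pure_state \<psi> = (\<chi> m n. \<psi> $ m * cnj (\<psi> $ n))"

definition complex_linear_map :: "(complex^'n^'n \<Rightarrow> complex^'n^'n) \<Rightarrow> bool" where
  "complex_linear_map \<E> \<longleftrightarrow>
     (\<forall>X Y. \<E> (X + Y) = \<E> X + \<E> Y) \<and>
     (\<forall>c X. \<E> (\<chi> m n. c * X $ m $ n) = (\<chi> m n. c * \<E> X $ m $ n))"

text \<open>The map id tensor E, acting block by block on an ancilla with basis indexed by nat.\<close>

definition ampliation :: "(complex^'n^'n \<Rightarrow> complex^'n^'n) \<Rightarrow> (nat \<times> 'n) op \<Rightarrow> (nat \<times> 'n) op" where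
  "ampliation \<E> X = (\<lambda>(i, m) (j, n). \<E> (\<chi> m' n'. X (i, m') (j, n')) $ m $ n)"

definition completely_positive :: "(complex^'n^'n \<Rightarrow> complex^'n^'n) \<Rightarrow> bool" where
  "completely_positive \<E> \<longleftrightarrow>
     (\<forall>k X. op_psd ({..<k} \<times> UNIV) X \<longrightarrow> op_psd ({..<k} \<times> UNIV) (ampliation \<E> X))"

definition quantum_operation :: "(complex^'n^'n \<Rightarrow> complex^'n^'n) \<Rightarrow> bool" where
  "quantum_operation \<E> \<longleftrightarrow>
     complex_linear_map \<E> \<and> completely_positive \<E> \<and> (\<forall>X. trace (\<E> X) = trace X)"

definition time_translation_symmetric ::
    "real^'n \<Rightarrow> (complex^'n^'n \<Rightarrow> complex^'n^'n) \<Rightarrow> bool" where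
  "time_translation_symmetric h \<E> \<longleftrightarrow>
     (\<forall>(t::real) \<rho>. \<E> (exp_ham (- \<i> * complex_of_real t) h ** \<rho> ** exp_ham (\<i> * complex_of_real t) h)
        = exp_ham (- \<i> * complex_of_real t) h ** \<E> \<rho> ** exp_ham (\<i> * complex_of_real t) h)"

definition enhanced_thermal_operation ::
    "real \<Rightarrow> real^'n \<Rightarrow> (complex^'n^'n \<Rightarrow> complex^'n^'n) \<Rightarrow> bool" where
  "enhanced_thermal_operation \<beta> h \<E> \<longleftrightarrow>
     quantum_operation \<E> \<and> time_translation_symmetric h \<E> \<and> \<E> (gibbs_sys \<beta> h) = gibbs_sys \<beta> h"


text \<open>
  A heat bath is given by an index set I of a basis of energy eigenvectors and the energy of each
  of them. Existence of the Gibbs state (finiteness of the partition function) forces the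
  spectrum to be discrete and I to be countable, so taking I to be a set of naturals, finite or
  infinite, is no restriction; it also forces all degeneracies to be finite.
\<close>

definition partition_fun :: "real \<Rightarrow> nat set \<Rightarrow> (nat \<Rightarrow> real) \<Rightarrow> real" where
  "partition_fun \<beta> I e = (\<Sum>\<^sub>\<infinity>i\<in>I. exp (- \<beta> * e i))"

definition gibbs_bath :: "real \<Rightarrow> nat set \<Rightarrow> (nat \<Rightarrow> real) \<Rightarrow> nat op" where
  "gibbs_bath \<beta> I e = op_diag (\<lambda>i. complex_of_real (exp (- \<beta> * e i) / partition_fun \<beta> I e))"

definition energies :: "nat set \<Rightarrow> (nat \<Rightarrow> real) \<Rightarrow> real set" where
  "energies I e = e ` I"

definition energy_proj :: "(nat \<Rightarrow> real) \<Rightarrow> real \<Rightarrow> nat op" where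
  "energy_proj e E = op_diag (\<lambda>i. if e i = E then 1 else 0)"

definition degeneracy :: "nat set \<Rightarrow> (nat \<Rightarrow> real) \<Rightarrow> real \<Rightarrow> nat" where
  "degeneracy I e E = card {i \<in> I. e i = E}"

definition heat_bath :: "real \<Rightarrow> nat set \<Rightarrow> (nat \<Rightarrow> real) \<Rightarrow> bool" where
  "heat_bath \<beta> I e \<longleftrightarrow> I \<noteq> {} \<and> (\<lambda>i. exp (- \<beta> * e i)) summable_on I \<and>
     mono_on (energies I e) (degeneracy I e)"

text \<open>
  The energy quantum is written w. In the second condition the shifted energies are required to
  be energy levels of the bath, rather than to lie in R again: a nonempty set of levels closed
  under these shifts is unbounded below, which is incompatible with a finite partition function.
\<close>

definition large_heat_bath ::
    "real \<Rightarrow> real \<Rightarrow> real \<Rightarrow> nat set \<Rightarrow> (nat \<Rightarrow> real) \<Rightarrow> bool" where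
  "large_heat_bath \<beta> w \<delta> I e \<longleftrightarrow> heat_bath \<beta> I e \<and>
     (\<exists>R \<subseteq> energies I e.
        ((\<lambda>E. op_trace I (op_mult I (gibbs_bath \<beta> I e) (energy_proj e E)))
           has_sum complex_of_real (1 - \<delta>)) R \<and>
        (\<forall>E\<in>R. \<forall>m\<in>{1, 2::nat}. E + real m * w \<in> energies I e \<and> E - real m * w \<in> energies I e) \<and>
        (\<forall>E\<in>R. \<forall>m\<in>{1, 2::nat}.
           \<bar>real (degeneracy I e (E - real m * w)) / (real (degeneracy I e E) * exp (- \<beta> * w) ^ m) - 1\<bar>
             \<le> \<delta>))"

definition total_ham :: "real^'n \<Rightarrow> (nat \<Rightarrow> real) \<Rightarrow> ('n \<times> nat) op" where
  "total_ham h e =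
     op_add (op_tensor (op_diag (\<lambda>m. complex_of_real (h $ m))) op_id)
            (op_tensor op_id (op_diag (\<lambda>i. complex_of_real (e i))))"

definition partial_trace_bath :: "nat set \<Rightarrow> ('n \<times> nat) op \<Rightarrow> complex^'n^'n" where
  "partial_trace_bath I X = (\<chi> m n. \<Sum>\<^sub>\<infinity>i\<in>I. X (m, i) (n, i))"

definition thermal_map ::
    "real \<Rightarrow> nat set \<Rightarrow> (nat \<Rightarrow> real) \<Rightarrow> ('n \<times> nat) op \<Rightarrow> complex^'n^'n \<Rightarrow> complex^'n^'n" where
  "thermal_map \<beta> I e U \<rho> =
     (let A = UNIV \<times> I in
      partial_trace_bath I
        (op_mult A (op_mult A U (op_tensor (op_of_mat \<rho>) (gibbs_bath \<beta> I e))) (op_adj U)))"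

definition thermal_operation ::
    "real \<Rightarrow> real^'n \<Rightarrow> nat set \<Rightarrow> (nat \<Rightarrow> real) \<Rightarrow> (complex^'n^'n \<Rightarrow> complex^'n^'n) \<Rightarrow> bool" where
  "thermal_operation \<beta> h I e \<E> \<longleftrightarrow>
     (\<exists>U. op_unitary (UNIV \<times> I) U \<and> op_commute (UNIV \<times> I) U (total_ham h e) \<and>
          \<E> = thermal_map \<beta> I e U)"


text \<open>
  The basis vectors |0>, |1>, |2> of the qutrit are the elements 1, 2, 3 of the index type 3.
\<close>

definition qutrit_energy :: "real \<Rightarrow> real^3" where
  "qutrit_energy w = vector [0, w, 2 * w]"

definition initial_state :: "complex^3^3" where
  "initial_state = pure_state (vector [complex_of_real (1 / sqrt 2), complex_of_real (1 / sqrt 2), 0])"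

definition target_state :: "real \<Rightarrow> real \<Rightarrow> complex^3^3" where
  "target_state \<beta> w =
     (let p = exp (- 2 * \<beta> * w) in
      (1 / 2) *\<^sub>R vector [vector [complex_of_real (1 - p), complex_of_real (sqrt (1 - p)), 0],
                       vector [complex_of_real (sqrt (1 - p)), 1, 0],
                       vector [0, 0, complex_of_real p]])"

end

theory Submission
  imports Defs
begin

text \<open>
  Write U_mn for the bath blocks of an energy-preserving unitary and q for the Boltzmann factor of one quantum. The
  output coherence is the Gibbs average of tr (U_00 U_11*) over bath levels. On the level E, the
  0-sector components u_r of the rows r of U resolve the identity, so this trace is the sum of the
  inner products of U_00 u_r and U_11 u_r. Transferring population q^2 from |0> to |2> forces the
  rows in the |2>-sector to have norm close to 1, and then U maps u_r almost entirely to the basis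
  vector r, which leaves U_00 u_r close to 0. Those rows carry weight q^2, so the coherence is at
  most about 1 - q^2, whereas the target needs sqrt (1 - q^2). That the population of |2> can
  only come from |0> is forced by the coherence through Cauchy-Schwarz.
\<close>

lemma sum_over_Times: "(\<Sum>z\<in>A \<times> B. f z) = (\<Sum>a\<in>A. \<Sum>b\<in>B. f (a, b))"
  by (simp add: sum.cartesian_product)

section \<open>An enhanced thermal operation\<close>

text \<open>The expression that \<open>op_psd\<close> tests, for an ancilla of dimension
  \<open>k\<close>. Naming it turns complete positivity into an additive identity between
  forms.\<close>

definition quadratic_form :: "nat \<Rightarrow> (nat \<times> 3) op \<Rightarrow> (nat \<times> 3 \<Rightarrow> complex) \<Rightarrow> complex" where
  "quadratic_form k X v =
     (\<Sum>x\<in>{..<k} \<times> UNIV. \<Sum>y\<in>{..<k} \<times> UNIV. cnj (v x) * X x y * v y)"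

lemma quadratic_form_blocks:
  "quadratic_form k X v =
     (\<Sum>i<k. \<Sum>j<k. \<Sum>m\<in>UNIV. \<Sum>n\<in>UNIV. cnj (v (i, m)) * X (i, m) (j, n) * v (j, n))"
proof -
  have "quadratic_form k X v =
     (\<Sum>i<k. \<Sum>m\<in>UNIV. \<Sum>j<k. \<Sum>n\<in>UNIV. cnj (v (i, m)) * X (i, m) (j, n) * v (j, n))"
    by (simp only: quadratic_form_def sum_over_Times)
  also have "\<dots> = (\<Sum>i<k. \<Sum>j<k. \<Sum>m\<in>UNIV. \<Sum>n\<in>UNIV. cnj (v (i, m)) * X (i, m) (j, n) * v (j, n))"
    by (intro sum.cong refl sum.swap)
  finally show ?thesis .
qed

text \<open>The Kraus operators are sqrt (1 - q^2) |0><0| + |1><1|, q |2><0| and |0><2|.\<close>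

definition swap_channel :: "real \<Rightarrow> complex^3^3 \<Rightarrow> complex^3^3" where
  "swap_channel q X =
     vector [vector [complex_of_real (1 - q\<^sup>2) * X$1$1 + X$3$3, complex_of_real (sqrt (1 - q\<^sup>2)) * X$1$2, 0],
             vector [complex_of_real (sqrt (1 - q\<^sup>2)) * X$2$1, X$2$2, 0],
             vector [0, 0, complex_of_real (q\<^sup>2) * X$1$1]]"

text \<open>One summand per Kraus operator: the form of \<open>X\<close> evaluated at the adjoint
  Kraus operator applied to \<open>v\<close>. Positivity is then evident.\<close>

lemma quadratic_form_swap_channel:
  fixes v :: "nat \<times> 3 \<Rightarrow> complex"
  assumes "q\<^sup>2 \<le> 1"
  shows "quadratic_form k (ampliation (swap_channel q) X) v =
           quadratic_form k X (\<lambda>(i, m). if m = 1 then complex_of_real (sqrt (1 - q\<^sup>2)) * v (i, 1)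
                                        else if m = 2 then v (i, 2) else 0)
         + quadratic_form k X (\<lambda>(i, m). if m = 1 then complex_of_real q * v (i, 3) else 0)
         + quadratic_form k X (\<lambda>(i, m). if m = 3 then v (i, 1) else 0)"
proof -
  define s where "s = complex_of_real (sqrt (1 - q\<^sup>2))"
  have s: "complex_of_real (1 - q\<^sup>2) = s * s" "cnj s = s"
    using assms by (simp_all add: s_def flip: of_real_mult)
  have q: "complex_of_real (q\<^sup>2) = complex_of_real q * complex_of_real q"
    by (simp add: power2_eq_square)
  show ?thesis
    unfolding quadratic_form_blocks s_def[symmetric] sum.distrib[symmetric]
    by (rule sum.cong[OF refl], rule sum.cong[OF refl])
       (simp add: sum_3 ampliation_def swap_channel_def s s_def[symmetric] q
        algebra_simps del: of_real_diff of_real_power)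
qed

lemma completely_positive_swap_channel:
  assumes "q\<^sup>2 \<le> 1"
  shows "completely_positive (swap_channel q)"
  unfolding completely_positive_def op_psd_def quadratic_form_def[symmetric]
    quadratic_form_swap_channel[OF assms]
  by (intro allI impI nonneg_Reals_add_I) blast+

lemma quantum_operation_swap_channel:
  assumes "q\<^sup>2 \<le> 1"
  shows "quantum_operation (swap_channel q)"
  unfolding quantum_operation_def complex_linear_map_def
  using completely_positive_swap_channel[OF assms]
  by (simp add: swap_channel_def vec_eq_iff forall_3 trace_def sum_3 algebra_simps)

lemma exp_ham_conjugation:
  "(exp_ham a h ** X ** exp_ham b h) $ m $ n =
     exp (a * complex_of_real (h $ m)) * X $ m $ n * exp (b * complex_of_real (h $ n))"
  by (simp add: exp_ham_def matrix_matrix_mult_def if_distrib if_distribR sum.delta sum.delta'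
      cong: if_cong)

text \<open>Diagonal outputs come from diagonal inputs and each coherence only from itself, so every
  output entry carries the phase of its sources.\<close>

lemma time_translation_symmetric_swap_channel:
  "time_translation_symmetric h (swap_channel q)"
  unfolding time_translation_symmetric_def
  by (simp add: vec_eq_iff forall_3 exp_ham_conjugation swap_channel_def algebra_simps
      flip: exp_add)

text \<open>The Gibbs weights of |0> and |2> are in the ratio 1 to \<open>q\<^sup>2\<close>: |0>
  keeps the fraction \<open>1 - q\<^sup>2\<close> and regains \<open>q\<^sup>2\<close> from |2>,
  which is refilled with \<open>q\<^sup>2\<close>.\<close>

lemma gibbs_swap_channel:
  assumes "q = exp (- \<beta> * w)"
  shows "swap_channel q (gibbs_sys \<beta> (qutrit_energy w)) = gibbs_sys \<beta> (qutrit_energy w)"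
proof -
  have "complex_of_real (q\<^sup>2) = exp (- (2 * (complex_of_real \<beta> * complex_of_real w)))"
    by (simp add: assms exp_of_real[symmetric] power2_eq_square flip: exp_add)
  moreover have "exp (- (complex_of_real \<beta> * (2 * complex_of_real w))) = exp (- (2 * (complex_of_real \<beta> * complex_of_real w)))"
    by (simp add: mult_ac)
  ultimately show ?thesis
    by (simp add: vec_eq_iff forall_3 swap_channel_def gibbs_sys_def exp_ham_def
        qutrit_energy_def Let_def algebra_simps diff_divide_distrib)
qed

lemma swap_channel_initial_state:
  assumes "q = exp (- \<beta> * w)"
  shows "swap_channel q initial_state = target_state \<beta> w"
proof -
  have "q\<^sup>2 = exp (- 2 * \<beta> * w)"
    by (simp add: assms power2_eq_square flip: exp_add)
  moreover have "complex_of_real (1 / sqrt 2) * complex_of_real (1 / sqrt 2) = 1/2"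
    by (simp flip: of_real_mult)
  ultimately show ?thesis
    unfolding vec_eq_iff forall_3 target_state_def Let_def vector_scaleR_component
    by (simp add: swap_channel_def initial_state_def pure_state_def scaleR_conv_of_real field_simps del: of_real_diff)
qed

lemma target_state_enhanced_thermal:
  assumes "\<beta> > 0" "w > 0"
  shows "\<exists>\<E>. enhanced_thermal_operation \<beta> (qutrit_energy w) \<E> \<and> \<E> initial_state = target_state \<beta> w"
proof -
  define q where "q = exp (- \<beta> * w)"
  have "q\<^sup>2 \<le> 1"
    using assms by (simp add: q_def power_le_one)
  then show ?thesis
    unfolding enhanced_thermal_operation_def
    using quantum_operation_swap_channel time_translation_symmetric_swap_channel
      gibbs_swap_channel[OF q_def] swap_channel_initial_state[OF q_def] by blast
qed

section \<open>Overlaps of blocks of isometries\<close>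

lemma isometry_norm:
  fixes M :: "'r \<Rightarrow> 'j \<Rightarrow> complex"
  assumes orth: "\<And>j j'. j \<in> J \<Longrightarrow> j' \<in> J \<Longrightarrow>
      (\<Sum>r\<in>R. cnj (M r j) * M r j') = (if j = j' then 1 else 0)"
    and "finite J"
  shows "(\<Sum>r\<in>R. (cmod (\<Sum>j\<in>J. M r j * v j))\<^sup>2) = (\<Sum>j\<in>J. (cmod (v j))\<^sup>2)"
proof -
  have "complex_of_real (\<Sum>r\<in>R. (cmod (\<Sum>j\<in>J. M r j * v j))\<^sup>2)
      = (\<Sum>r\<in>R. (\<Sum>j\<in>J. cnj (M r j * v j)) * (\<Sum>j'\<in>J. M r j' * v j'))"
    by (simp add: complex_norm_square mult.commute del: of_real_power)
  also have "\<dots> = (\<Sum>r\<in>R. \<Sum>j\<in>J. \<Sum>j'\<in>J. cnj (v j) * v j' * (cnj (M r j) * M r j'))"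
    unfolding sum_product by (simp add: mult_ac)
  also have "\<dots> = (\<Sum>j\<in>J. \<Sum>j'\<in>J. cnj (v j) * v j' * (\<Sum>r\<in>R. cnj (M r j) * M r j'))"
    by (subst sum.swap) (intro sum.cong refl, subst sum.swap, simp add: sum_distrib_left)
  also have "\<dots> = (\<Sum>j\<in>J. cnj (v j) * v j)"
    by (intro sum.cong refl) (simp add: orth \<open>finite J\<close> if_distrib sum.delta' cong: if_cong)
  also have "\<dots> = complex_of_real (\<Sum>j\<in>J. (cmod (v j))\<^sup>2)"
    by (simp add: complex_norm_square mult.commute del: of_real_power)
  finally show ?thesis
    by (simp only: of_real_eq_iff)
qed

text \<open>Orthonormal columns make the conjugated rows of \<open>M\<close> a resolution of the
  identity on \<open>J\<close>, which is inserted between \<open>x\<close> and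
  \<open>y\<close>.\<close>

lemma isometry_overlap_expansion:
  fixes M :: "'r \<Rightarrow> 'j \<Rightarrow> complex"
  assumes orth: "\<And>j j'. j \<in> J \<Longrightarrow> j' \<in> J \<Longrightarrow>
      (\<Sum>r\<in>R. cnj (M r j) * M r j') = (if j = j' then 1 else 0)"
    and "finite J"
  shows "(\<Sum>j\<in>J. x j * cnj (y j)) =
    (\<Sum>r\<in>R. (\<Sum>j\<in>J. x j * cnj (M r j)) * cnj (\<Sum>j\<in>J. y j * cnj (M r j)))"
proof -
  have "(\<Sum>r\<in>R. (\<Sum>j\<in>J. x j * cnj (M r j)) * cnj (\<Sum>j\<in>J. y j * cnj (M r j)))
      = (\<Sum>r\<in>R. \<Sum>j\<in>J. \<Sum>j'\<in>J. x j * cnj (y j') * (cnj (M r j) * M r j'))"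
    by (simp add: sum_product mult_ac)
  also have "\<dots> = (\<Sum>j\<in>J. \<Sum>j'\<in>J. x j * cnj (y j') * (\<Sum>r\<in>R. cnj (M r j) * M r j'))"
    by (subst sum.swap) (intro sum.cong refl, subst sum.swap, simp add: sum_distrib_left)
  also have "\<dots> = (\<Sum>j\<in>J. x j * cnj (y j))"
    by (intro sum.cong refl) (simp add: orth \<open>finite J\<close> if_distrib sum.delta' cong: if_cong)
  finally show ?thesis ..
qed

text \<open>Young's inequality. The free weight lets a factor known to be small take a large
  coefficient, which leaves a small one for the other factor.\<close>

lemma Re_mult_cnj_le:
  assumes "\<kappa> > 0"
  shows "Re (z * cnj u) \<le> \<kappa> * (cmod z)\<^sup>2 + (cmod u)\<^sup>2 / (4 * \<kappa>)"
proof -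
  have "Re (z * cnj u) \<le> cmod z * cmod u"
    by (metis complex_Re_le_cmod complex_mod_cnj norm_mult)
  moreover have "0 \<le> (2 * \<kappa> * cmod z - cmod u)\<^sup>2 / (4 * \<kappa>)"
    using assms by simp
  moreover have "(2 * \<kappa> * cmod z - cmod u)\<^sup>2 / (4 * \<kappa>)
      = \<kappa> * (cmod z)\<^sup>2 + (cmod u)\<^sup>2 / (4 * \<kappa>) - cmod z * cmod u"
    using assms by (simp add: power2_eq_square field_simps)
  ultimately show ?thesis by linarith
qed

text \<open>
  Expanding the overlap of two contractions over the resolution of the identity by the rows of M,
  a row r in R2 contributes little whenever its norm is close to 1: then M maps its conjugate
  close to the basis vector r, hence almost to zero on K.
\<close>

lemma isometry_block_overlap_bound:
  fixes M N :: "'r \<Rightarrow> 'j \<Rightarrow> complex" and \<kappa> :: real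
  assumes fin: "finite R" "finite J" and sub: "R2 \<subseteq> R" "K \<subseteq> R - R2"
    and orth: "\<And>j j'. j \<in> J \<Longrightarrow> j' \<in> J \<Longrightarrow>
      (\<Sum>r\<in>R. cnj (M r j) * M r j') = (if j = j' then 1 else 0)"
    and row: "\<And>r. r \<in> R2 \<Longrightarrow> (\<Sum>j\<in>J. (cmod (M r j))\<^sup>2) \<le> 1"
    and contr: "\<And>v. (\<Sum>k\<in>K. (cmod (\<Sum>j\<in>J. N k j * v j))\<^sup>2) \<le> (\<Sum>j\<in>J. (cmod (v j))\<^sup>2)"
    and \<kappa>: "\<kappa> > 0"
    and t: "t = (\<Sum>r\<in>R2. \<Sum>j\<in>J. (cmod (M r j))\<^sup>2)"
  shows "(\<Sum>k\<in>K. \<Sum>j\<in>J. Re (M k j * cnj (N k j)))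
     \<le> real (card J) - t + \<kappa> * (real (card R2) - t) + real (card R2) / (4 * \<kappa>)"
proof -
  define n where "n r = (\<Sum>j\<in>J. (cmod (M r j))\<^sup>2)" for r
  \<comment> \<open>With u_r the conjugate of row \<open>r\<close>, these are the entries
    \<open>k\<close> of M u_r and N u_r.\<close>
  define a where "a r k = (\<Sum>j\<in>J. M k j * cnj (M r j))" for r k
  define b where "b r k = (\<Sum>j\<in>J. N k j * cnj (M r j))" for r k
  have n0: "0 \<le> n r" for r by (simp add: n_def sum_nonneg)
  have finK: "finite K" "finite R2" using fin sub by (auto intro: finite_subset)
  have isom: "(\<Sum>k\<in>R. (cmod (a r k))\<^sup>2) = n r" for r
    using isometry_norm[OF orth \<open>finite J\<close>, of "\<lambda>j. cnj (M r j)"] by (simp add: a_def n_def)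
  have isomK: "(\<Sum>k\<in>K. (cmod (a r k))\<^sup>2) \<le> n r" for r
    unfolding isom[of r, symmetric] by (rule sum_mono2) (use fin sub in auto)
  have b: "(\<Sum>k\<in>K. (cmod (b r k))\<^sup>2) \<le> n r" for r
    using contr[of "\<lambda>j. cnj (M r j)"] by (simp add: b_def n_def)
  \<comment> \<open>Row \<open>r\<close> lies outside \<open>K\<close>, and its own entry
    \<open>a r r\<close>, equal to \<open>n r\<close>, already uses up \<open>(n r)\<^sup>2\<close>
    of the squared norm \<open>n r\<close>.\<close>
  have isomR2: "(\<Sum>k\<in>K. (cmod (a r k))\<^sup>2) \<le> n r - (n r)\<^sup>2" if "r \<in> R2" for r
  proof -
    have "a r r = complex_of_real (n r)"
      by (simp add: a_def n_def complex_norm_square del: of_real_power)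
    then have "(cmod (a r r))\<^sup>2 = (n r)\<^sup>2" using n0 by simp
    moreover have "(\<Sum>k\<in>insert r K. (cmod (a r k))\<^sup>2) \<le> n r"
      unfolding isom[of r, symmetric] by (rule sum_mono2) (use fin sub that in auto)
    ultimately show ?thesis using sub that finK by (subst (asm) sum.insert) auto
  qed
  have total: "(\<Sum>r\<in>R. n r) = real (card J)"
  proof -
    have "(\<Sum>r\<in>R. (cmod (M r j))\<^sup>2) = 1" if "j \<in> J" for j
    proof -
      have "complex_of_real (\<Sum>r\<in>R. (cmod (M r j))\<^sup>2) = (\<Sum>r\<in>R. cnj (M r j) * M r j)"
        by (simp add: complex_norm_square mult.commute del: of_real_power)
      also have "\<dots> = 1" using orth[OF that that] by simp
      finally show ?thesis by (simp only: of_real_eq_1_iff)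
    qed
    then show ?thesis unfolding n_def by (subst sum.swap) simp
  qed
  have "(\<Sum>k\<in>K. \<Sum>j\<in>J. Re (M k j * cnj (N k j))) = Re (\<Sum>k\<in>K. \<Sum>j\<in>J. M k j * cnj (N k j))"
    by simp
  also have "(\<Sum>k\<in>K. \<Sum>j\<in>J. M k j * cnj (N k j)) = (\<Sum>k\<in>K. \<Sum>r\<in>R. a r k * cnj (b r k))"
    unfolding a_def b_def by (intro sum.cong refl isometry_overlap_expansion orth fin)
  also have "\<dots> = (\<Sum>r\<in>R. \<Sum>k\<in>K. a r k * cnj (b r k))" by (rule sum.swap)
  also have "Re \<dots> = (\<Sum>r\<in>R - R2. \<Sum>k\<in>K. Re (a r k * cnj (b r k)))
                    + (\<Sum>r\<in>R2. \<Sum>k\<in>K. Re (a r k * cnj (b r k)))"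
    using sum.subset_diff[OF sub(1) fin(1), of "\<lambda>r. \<Sum>k\<in>K. Re (a r k * cnj (b r k))"] by simp
  \<comment> \<open>Outside \<open>R2\<close> both vectors are only known to have squared norm at
    most \<open>n r\<close>, so the symmetric weight 1/2 is used.\<close>
  also have "(\<Sum>r\<in>R - R2. \<Sum>k\<in>K. Re (a r k * cnj (b r k))) \<le> (\<Sum>r\<in>R - R2. n r)"
  proof (rule sum_mono)
    fix r
    have "(\<Sum>k\<in>K. Re (a r k * cnj (b r k))) \<le> (\<Sum>k\<in>K. (1/2) * (cmod (a r k))\<^sup>2 + (cmod (b r k))\<^sup>2 / (4 * (1/2)))"
      by (intro sum_mono Re_mult_cnj_le) simp
    also have "\<dots> = (1/2) * (\<Sum>k\<in>K. (cmod (a r k))\<^sup>2) + (\<Sum>k\<in>K. (cmod (b r k))\<^sup>2) / 2"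
      by (simp add: sum.distrib sum_distrib_left sum_divide_distrib)
    finally show "(\<Sum>k\<in>K. Re (a r k * cnj (b r k))) \<le> n r"
      using isomK[of r] b[of r] by linarith
  qed
  also have "(\<Sum>r\<in>R - R2. n r) = real (card J) - t"
    using sum.subset_diff[OF sub(1) fin(1), of n] total by (simp add: t n_def)
  \<comment> \<open>Inside \<open>R2\<close> the weight \<kappa> falls on the part of M u_r in
    \<open>K\<close>, of squared norm at most \<open>1 - n r\<close>, so a large \<kappa> is
    affordable for rows of norm near 1.\<close>
  also have "(\<Sum>r\<in>R2. \<Sum>k\<in>K. Re (a r k * cnj (b r k))) \<le> (\<Sum>r\<in>R2. \<kappa> * (1 - n r) + 1 / (4 * \<kappa>))"
  proof (rule sum_mono)
    fix r assume r: "r \<in> R2"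
    have n1: "n r \<le> 1" using row[OF r] by (simp add: n_def)
    have "(\<Sum>k\<in>K. Re (a r k * cnj (b r k))) \<le> (\<Sum>k\<in>K. \<kappa> * (cmod (a r k))\<^sup>2 + (cmod (b r k))\<^sup>2 / (4 * \<kappa>))"
      by (intro sum_mono Re_mult_cnj_le \<kappa>)
    also have "\<dots> = \<kappa> * (\<Sum>k\<in>K. (cmod (a r k))\<^sup>2) + (\<Sum>k\<in>K. (cmod (b r k))\<^sup>2) / (4 * \<kappa>)"
      by (simp add: sum.distrib sum_distrib_left sum_divide_distrib)
    also have "\<dots> \<le> \<kappa> * (1 - n r) + 1 / (4 * \<kappa>)"
    proof (intro add_mono mult_left_mono divide_right_mono)
      have "n r - (n r)\<^sup>2 = n r * (1 - n r)" by (simp add: power2_eq_square algebra_simps)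
      also have "\<dots> \<le> 1 * (1 - n r)" using n1 by (intro mult_right_mono) auto
      finally show "(\<Sum>k\<in>K. (cmod (a r k))\<^sup>2) \<le> 1 - n r" using isomR2[OF r] by simp
      show "(\<Sum>k\<in>K. (cmod (b r k))\<^sup>2) \<le> 1" using b[of r] n1 by linarith
    qed (use \<kappa> in auto)
    finally show "(\<Sum>k\<in>K. Re (a r k * cnj (b r k))) \<le> \<kappa> * (1 - n r) + 1 / (4 * \<kappa>)" .
  qed
  also have "\<dots> = \<kappa> * (real (card R2) - t) + real (card R2) / (4 * \<kappa>)"
    by (simp add: t n_def[symmetric] sum.distrib sum_subtractf flip: sum_distrib_left)
  finally show ?thesis by simp
qed

section \<open>Energy-preserving unitaries on system and bath\<close>

text \<open>Turns infinite matrix products into finite sums; in the applications \<open>S\<close> is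
  an energy shell or consists of a few basis vectors.\<close>

lemma op_mult_finite_support:
  assumes "finite S" "S \<subseteq> A" "\<And>z. z \<in> A - S \<Longrightarrow> X x z = 0 \<or> Y z y = 0"
  shows "op_mult A X Y x y = (\<Sum>z\<in>S. X x z * Y z y)"
proof -
  have "op_mult A X Y x y = (\<Sum>\<^sub>\<infinity>z\<in>S. X x z * Y z y)"
    unfolding op_mult_def by (rule infsum_cong_neutral) (use assms in fastforce)+
  then show ?thesis using assms by simp
qed

lemma has_sum_finite_sum:
  fixes f :: "'a \<Rightarrow> 'b \<Rightarrow> 'c::topological_comm_monoid_add"
  assumes "finite A" "\<And>a. a \<in> A \<Longrightarrow> (f a has_sum s a) B"
  shows "((\<lambda>x. \<Sum>a\<in>A. f a x) has_sum (\<Sum>a\<in>A. s a)) B"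
  using assms by (induction A rule: finite_induct) (auto intro!: has_sum_add)

text \<open>Used to regroup sums over bath eigenvectors by energy. The index \<open>y\<close> runs
  over all reals; empty fibres contribute 0.\<close>

lemma has_sum_fibres:
  fixes f :: "'a \<Rightarrow> 'c::{topological_comm_monoid_add,t3_space}"
  assumes "(f has_sum s) A" "\<And>y. finite {x \<in> A. g x = y}"
  shows "((\<lambda>y. \<Sum>x\<in>{x \<in> A. g x = y}. f x) has_sum s) UNIV"
proof (rule has_sum_SigmaD[where B = "\<lambda>y. {x \<in> A. g x = y}" and f = "\<lambda>(y, x). f x"])
  have "bij_betw snd (Sigma UNIV (\<lambda>y. {x \<in> A. g x = y})) A"
    by (rule bij_betw_byWitness[where f' = "\<lambda>x. (g x, x)"]) auto
  from has_sum_reindex_bij_betw[OF this, of f s] assms(1)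
  show "((\<lambda>(y, x). f x) has_sum s) (Sigma UNIV (\<lambda>y. {x \<in> A. g x = y}))"
    by (simp add: split_def)
qed (use assms(2) in auto)

lemma has_sum_translate:
  fixes f :: "real \<Rightarrow> 'c::{comm_monoid_add,topological_space}"
  shows "((\<lambda>E. f (E + a)) has_sum s) UNIV \<longleftrightarrow> (f has_sum s) UNIV"
  by (rule has_sum_reindex_bij_betw) (rule bij_betw_byWitness[where f' = "\<lambda>x. x - a"], auto)

locale energy_preserving_unitary =
  fixes \<beta> :: real and h :: "real^'n" and I :: "nat set" and e :: "nat \<Rightarrow> real"
    and U :: "('n \<times> nat) op"
  assumes bath: "heat_bath \<beta> I e"
    and unitary: "op_unitary (UNIV \<times> I) U"
    and commute: "op_commute (UNIV \<times> I) U (total_ham h e)"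
begin

definition level :: "real \<Rightarrow> nat set" where
  "level E = {i \<in> I. e i = E}"

definition shell :: "real \<Rightarrow> ('n \<times> nat) set" where
  "shell E = Sigma UNIV (\<lambda>m. level (E - h $ m))"

definition weight :: "real \<Rightarrow> real" where
  "weight E = exp (- \<beta> * E) / partition_fun \<beta> I e"

text \<open>\<open>E\<close> is the bath energy before the interaction and
  \<open>E + h $ b - h $ n\<close> the one after it, fixed by energy conservation. The sum is the
  trace of U_ma times the adjoint of U_nb.\<close>

definition overlap :: "'n \<Rightarrow> 'n \<Rightarrow> 'n \<Rightarrow> 'n \<Rightarrow> real \<Rightarrow> complex" where
  "overlap m n a b E =
     (\<Sum>i\<in>level (E + h $ b - h $ n). \<Sum>j\<in>level E. U (m, i) (a, j) * cnj (U (n, i) (b, j)))"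

text \<open>The squared Hilbert-Schmidt norm of the block U_ma on the bath level
  \<open>E\<close>.\<close>

definition flow :: "'n \<Rightarrow> 'n \<Rightarrow> real \<Rightarrow> real" where
  "flow m a E = (\<Sum>i\<in>level (E + h $ a - h $ m). \<Sum>j\<in>level E. (cmod (U (m, i) (a, j)))\<^sup>2)"

lemma in_level: "i \<in> level E \<longleftrightarrow> i \<in> I \<and> e i = E"
  by (simp add: level_def)

lemma summable_boltzmann: "(\<lambda>i. exp (- \<beta> * e i)) summable_on I"
  using bath by (simp add: heat_bath_def)

text \<open>An infinitely degenerate level would add the same positive term infinitely often to the
  partition function.\<close>

lemma finite_level [simp]: "finite (level E)"
proof (rule ccontr)
  assume inf: "infinite (level E)"
  have "(\<lambda>i. exp (- \<beta> * e i)) summable_on level E"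
    using summable_boltzmann by (rule summable_on_subset_banach) (auto simp: level_def)
  then have "(\<lambda>i. exp (- \<beta> * E)) summable_on level E"
    by (rule summable_on_cong[THEN iffD1, rotated]) (simp add: in_level)
  with infsum_diverge_constant[OF inf, of "exp (- \<beta> * E)"] show False by simp
qed

lemma finite_shell [simp]: "finite (shell E)"
  by (simp add: shell_def)

lemma shell_subset: "shell E \<subseteq> UNIV \<times> I"
  by (auto simp: shell_def level_def)

lemma in_shell: "(m, i) \<in> shell E \<longleftrightarrow> i \<in> I \<and> h $ m + e i = E"
  by (auto simp: shell_def level_def)

lemma sum_shell: "(\<Sum>r\<in>shell E. f r) = (\<Sum>m\<in>UNIV. \<Sum>i\<in>level (E - h $ m). f (m, i))"
  by (simp add: shell_def sum.Sigma)

lemma partition_fun_pos: "partition_fun \<beta> I e > 0"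
proof -
  obtain i where i: "i \<in> I" using bath by (auto simp: heat_bath_def)
  have "exp (- \<beta> * e i) \<le> partition_fun \<beta> I e"
    using finite_sum_le_infsum[OF summable_boltzmann, of "{i}"] i by (simp add: partition_fun_def)
  then show ?thesis using exp_gt_zero[of "- \<beta> * e i"] by linarith
qed

lemma weight_nonneg: "weight E \<ge> 0"
  using partition_fun_pos by (simp add: weight_def)

lemma weight_shift: "weight (E + a) = exp (- \<beta> * a) * weight E"
  by (simp add: weight_def algebra_simps flip: exp_add)

lemma has_sum_weight: "((\<lambda>i. weight (e i)) has_sum 1) I"
  using has_sum_divide_const[OF has_sum_infsum[OF summable_boltzmann], of "partition_fun \<beta> I e"]
    partition_fun_pos by (simp add: weight_def partition_fun_def)

lemma has_sum_weight_card: "((\<lambda>E. weight E * real (card (level E))) has_sum 1) UNIV"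
proof -
  have "((\<lambda>E. \<Sum>i\<in>level E. weight (e i)) has_sum 1) UNIV"
    using has_sum_fibres[OF has_sum_weight, of e, folded level_def] by simp
  moreover have "(\<Sum>i\<in>level E. weight (e i)) = weight E * real (card (level E))" for E
    by (simp add: in_level mult.commute)
  ultimately show ?thesis by simp
qed

text \<open>Substituting \<open>E + a\<close> for \<open>E\<close> produces the Boltzmann factor.
  With \<open>a = 2 * w\<close> this is the total weight \<open>q\<^sup>2\<close> of the rows in the
  |2>-sector.\<close>

lemma has_sum_weight_card_shift:
  "((\<lambda>E. weight E * real (card (level (E - a)))) has_sum exp (- \<beta> * a)) UNIV"
proof -
  have "((\<lambda>E. weight (E + a) * real (card (level (E + a - a)))) has_sum exp (- \<beta> * a)) UNIV"
    using has_sum_cmult_right[OF has_sum_weight_card, of "exp (- \<beta> * a)"]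
    by (simp add: weight_shift mult.assoc)
  then show ?thesis by (subst (asm) has_sum_translate)
qed

section \<open>Energy conservation and unitarity on finite shells\<close>

lemma unitary_conserves_energy:
  assumes "i \<in> I" "j \<in> I" "U (m, i) (a, j) \<noteq> 0"
  shows "h $ m + e i = h $ a + e j"
proof -
  \<comment> \<open>The total Hamiltonian is diagonal, so both products with \<open>U\<close> have a
    single term, and their equality compares total energies.\<close>
  have H: "total_ham h e x y = (if x = y then complex_of_real (h $ fst x + e (snd x)) else 0)" for x y
    by (auto simp: total_ham_def op_add_def op_tensor_def op_diag_def op_id_def split: prod.splits)
  have "op_mult (UNIV \<times> I) U (total_ham h e) (m, i) (a, j)
      = op_mult (UNIV \<times> I) (total_ham h e) U (m, i) (a, j)"
    using commute assms by (simp add: op_commute_def op_eq_on_def)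
  also have "op_mult (UNIV \<times> I) U (total_ham h e) (m, i) (a, j)
      = U (m, i) (a, j) * complex_of_real (h $ a + e j)"
    by (subst op_mult_finite_support[of "{(a, j)}"]) (use assms in \<open>auto simp: H\<close>)
  also have "op_mult (UNIV \<times> I) (total_ham h e) U (m, i) (a, j)
      = U (m, i) (a, j) * complex_of_real (h $ m + e i)"
    by (subst op_mult_finite_support[of "{(m, i)}"]) (use assms in \<open>auto simp: H\<close>)
  finally show ?thesis using assms by (simp only: mult_cancel_left of_real_eq_iff) simp
qed

text \<open>By energy conservation a column of \<open>U\<close> is supported on one finite shell,
  which makes the infinite sum in \<open>op_unitary\<close> finite.\<close>

lemma unitary_columns:
  assumes "j \<in> level (E - h $ a)" "j' \<in> level (E - h $ a)"
  shows "(\<Sum>r\<in>shell E. cnj (U r (a, j)) * U r (a, j')) = (if j = j' then 1 else 0)"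
proof -
  have I: "j \<in> I" "j' \<in> I" using assms by (auto simp: in_level)
  have "op_mult (UNIV \<times> I) (op_adj U) U (a, j) (a, j') = (\<Sum>r\<in>shell E. op_adj U (a, j) r * U r (a, j'))"
  proof (rule op_mult_finite_support)
    fix z assume "z \<in> UNIV \<times> I - shell E"
    then show "op_adj U (a, j) z = 0 \<or> U z (a, j') = 0"
      using unitary_conserves_energy[of "snd z" j' "fst z" a] assms
      by (cases z) (auto simp: in_shell in_level)
  qed (use shell_subset in auto)
  moreover have "op_mult (UNIV \<times> I) (op_adj U) U (a, j) (a, j') = op_id (a, j) (a, j')"
    using unitary I by (simp add: op_unitary_def op_eq_on_def)
  ultimately show ?thesis by (simp add: op_adj_def op_id_def op_diag_def)
qed

lemma unitary_column_norm:
  assumes "j \<in> level (E - h $ a)"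
  shows "(\<Sum>r\<in>shell E. (cmod (U r (a, j)))\<^sup>2) = 1"
proof -
  have "complex_of_real (\<Sum>r\<in>shell E. (cmod (U r (a, j)))\<^sup>2) = (\<Sum>r\<in>shell E. cnj (U r (a, j)) * U r (a, j))"
    by (simp add: complex_norm_square mult.commute del: of_real_power)
  also have "\<dots> = 1" using unitary_columns[OF assms assms] by simp
  finally show ?thesis by (simp only: of_real_eq_1_iff)
qed

text \<open>A row of a block is part of a unit row of \<open>U\<close>, or zero if the energies do
  not balance.\<close>

lemma unitary_row_norm:
  assumes "i \<in> I"
  shows "(\<Sum>j\<in>level E. (cmod (U (m, i) (a, j)))\<^sup>2) \<le> 1"
proof (cases "E + h $ a = h $ m + e i")
  case True
  define S where "S = shell (h $ m + e i)"
  have "op_mult (UNIV \<times> I) U (op_adj U) (m, i) (m, i) = (\<Sum>r\<in>S. U (m, i) r * op_adj U r (m, i))"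
  proof (rule op_mult_finite_support)
    fix z assume "z \<in> UNIV \<times> I - S"
    then have "U (m, i) z = 0"
      using unitary_conserves_energy[of i "snd z" m "fst z"] assms
      by (cases z; cases "U (m, i) z = 0") (auto simp: in_shell S_def)
    then show "U (m, i) z = 0 \<or> op_adj U z (m, i) = 0" ..
  qed (use shell_subset in \<open>auto simp: S_def\<close>)
  moreover have "op_mult (UNIV \<times> I) U (op_adj U) (m, i) (m, i) = op_id (m, i) (m, i)"
    using unitary assms by (simp add: op_unitary_def op_eq_on_def)
  ultimately have "complex_of_real (\<Sum>r\<in>S. (cmod (U (m, i) r))\<^sup>2) = 1"
    by (simp add: op_adj_def op_id_def op_diag_def complex_norm_square del: of_real_power)
  then have "(\<Sum>r\<in>S. (cmod (U (m, i) r))\<^sup>2) = 1" by (simp only: of_real_eq_1_iff)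
  moreover have "(\<Sum>r\<in>{a} \<times> level E. (cmod (U (m, i) r))\<^sup>2) \<le> (\<Sum>r\<in>S. (cmod (U (m, i) r))\<^sup>2)"
    by (rule sum_mono2) (use True in \<open>auto simp: S_def in_shell in_level\<close>)
  moreover have "(\<Sum>r\<in>{a} \<times> level E. (cmod (U (m, i) r))\<^sup>2) = (\<Sum>j\<in>level E. (cmod (U (m, i) (a, j)))\<^sup>2)"
    by (simp add: sum_over_Times)
  ultimately show ?thesis by simp
next
  case False
  then have "U (m, i) (a, j) = 0" if "j \<in> level E" for j
    using unitary_conserves_energy[of i j m a] assms that by (auto simp: in_level)
  then show ?thesis by simp
qed

lemma sum_flow: "(\<Sum>m\<in>UNIV. flow m a E) = real (card (level E))"
proof -
  have "(\<Sum>m\<in>UNIV. flow m a E)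
      = (\<Sum>r\<in>shell (E + h $ a). \<Sum>j\<in>level E. (cmod (U r (a, j)))\<^sup>2)"
    by (simp add: sum_shell flow_def)
  also have "\<dots> = (\<Sum>j\<in>level E. \<Sum>r\<in>shell (E + h $ a). (cmod (U r (a, j)))\<^sup>2)"
    by (rule sum.swap)
  also have "\<dots> = real (card (level E))"
    by (simp add: unitary_column_norm)
  finally show ?thesis .
qed

section \<open>Block overlaps and their Gibbs averages\<close>

lemma flow_nonneg: "flow m a E \<ge> 0"
  by (simp add: flow_def sum_nonneg)

lemma overlap_diag: "overlap m m a a E = complex_of_real (flow m a E)"
  by (simp add: overlap_def flow_def complex_norm_square del: of_real_power)

text \<open>Time-translation covariance: the output entry \<open>m\<close>, \<open>n\<close> is fed
  only by input entries with the same energy gap.\<close>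

lemma overlap_eq_0:
  assumes "h $ m + h $ b \<noteq> h $ n + h $ a"
  shows "overlap m n a b E = 0"
  unfolding overlap_def
proof (intro sum.neutral ballI)
  fix i j assume i: "i \<in> level (E + h $ b - h $ n)" and j: "j \<in> level E"
  show "U (m, i) (a, j) * cnj (U (n, i) (b, j)) = 0"
    using unitary_conserves_energy[of i j m a] i j assms
    by (auto simp: in_level)
qed

text \<open>The bound does not depend on the degeneracy, so Gibbs weights dominate the sum over the
  bath.\<close>

lemma overlap_term_bound:
  assumes "i \<in> I"
  shows "norm (\<Sum>j\<in>level E. U (m, i) (a, j) * cnj (U (n, i) (b, j))) \<le> 1"
proof -
  have "norm (\<Sum>j\<in>level E. U (m, i) (a, j) * cnj (U (n, i) (b, j)))
      \<le> (\<Sum>j\<in>level E. cmod (U (m, i) (a, j)) * cmod (U (n, i) (b, j)))"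
    by (rule order_trans[OF norm_sum]) (simp add: norm_mult)
  also have "\<dots> \<le> (\<Sum>j\<in>level E. ((cmod (U (m, i) (a, j)))\<^sup>2 + (cmod (U (n, i) (b, j)))\<^sup>2) / 2)"
  proof (rule sum_mono)
    fix j
    show "cmod (U (m, i) (a, j)) * cmod (U (n, i) (b, j))
        \<le> ((cmod (U (m, i) (a, j)))\<^sup>2 + (cmod (U (n, i) (b, j)))\<^sup>2) / 2"
      using sum_squares_bound[of "cmod (U (m, i) (a, j))" "cmod (U (n, i) (b, j))"] by simp
  qed
  also have "\<dots> \<le> 1"
    using unitary_row_norm[OF assms, of m a E] unitary_row_norm[OF assms, of n b E]
    by (simp add: sum.distrib flip: sum_divide_distrib)
  finally show ?thesis .
qed

text \<open>One sum in two arrangements: by the bath energy before the interaction, and by the bath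
  vector after it, over which the partial trace runs. Absolute convergence permits the
  regrouping.\<close>

lemma has_sum_overlap:
  obtains s where
    "((\<lambda>E. complex_of_real (weight E) * overlap m n a b E) has_sum s) UNIV"
    "((\<lambda>i. complex_of_real (weight (e i + h $ n - h $ b)) *
        (\<Sum>j\<in>level (e i + h $ n - h $ b). U (m, i) (a, j) * cnj (U (n, i) (b, j)))) has_sum s) I"
proof -
  \<comment> \<open>The bath energy before the interaction minus the one after it.\<close>
  define d where "d = h $ n - h $ b"
  define f where "f i = complex_of_real (weight (e i + d)) *
    (\<Sum>j\<in>level (e i + d). U (m, i) (a, j) * cnj (U (n, i) (b, j)))" for i
  define g where "g E = complex_of_real (weight E) * overlap m n a b E" for E
  have "(\<lambda>i. exp (- \<beta> * d) * weight (e i)) summable_on I"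
    using has_sum_weight by (intro summable_on_cmult_right) (rule has_sum_imp_summable)
  then have "(\<lambda>i. norm (f i)) summable_on I"
  proof (rule summable_on_comparison_test)
    fix i assume "i \<in> I"
    then show "norm (f i) \<le> exp (- \<beta> * d) * weight (e i)"
      using mult_left_mono[OF overlap_term_bound[of i m a n b "e i + d"] weight_nonneg[of "e i + d"]]
        weight_shift[of "e i" d]
      by (simp add: f_def norm_mult weight_nonneg)
  qed simp
  then have "f summable_on I" by (rule abs_summable_summable)
  then obtain s where s: "(f has_sum s) I" by (auto simp: summable_on_def)
  have "((\<lambda>E. \<Sum>i\<in>level E. f i) has_sum s) UNIV"
    using has_sum_fibres[OF s, of e, folded level_def] by simp
  moreover have "(\<Sum>i\<in>level E. f i) = g (E + d)" for E
    by (simp add: f_def g_def overlap_def d_def in_level sum_distrib_left add_diff_eq)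
  ultimately have "((\<lambda>E. g (E + d)) has_sum s) UNIV" by simp
  then have "(g has_sum s) UNIV" by (simp only: has_sum_translate)
  from that[OF this[unfolded g_def[abs_def]] s[unfolded f_def[abs_def] d_def add_diff_eq]]
  show ?thesis .
qed

text \<open>Both matrix products are finite: the Gibbs state is diagonal, and row
  \<open>(n, i)\<close> of \<open>U\<close> lies in one shell. \<open>has_sum_overlap\<close> then
  trades the final bath vector for the initial bath energy.\<close>

lemma thermal_map_entry:
  "thermal_map \<beta> I e U \<rho> $ m $ n =
     (\<Sum>a\<in>UNIV. \<Sum>b\<in>UNIV. \<rho> $ a $ b * (\<Sum>\<^sub>\<infinity>E. complex_of_real (weight E) * overlap m n a b E))"
proof -
  define \<tau> where "\<tau> = op_tensor (op_of_mat \<rho>) (gibbs_bath \<beta> I e)"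
  define F where "F a b i = complex_of_real (weight (e i + h $ n - h $ b)) *
        (\<Sum>j\<in>level (e i + h $ n - h $ b). U (m, i) (a, j) * cnj (U (n, i) (b, j)))" for a b i
  have \<tau>: "\<tau> (a, l) (b, j) = (if l = j then \<rho> $ a $ b * complex_of_real (weight (e j)) else 0)" for a b l j
    by (simp add: \<tau>_def op_tensor_def op_of_mat_def gibbs_bath_def op_diag_def weight_def)
  have left: "op_mult (UNIV \<times> I) U \<tau> x (b, j) = (\<Sum>a\<in>UNIV. U x (a, j) * (\<rho> $ a $ b * complex_of_real (weight (e j))))"
    if "j \<in> I" for x b j
  proof -
    have "op_mult (UNIV \<times> I) U \<tau> x (b, j) = (\<Sum>z\<in>UNIV \<times> {j}. U x z * \<tau> z (b, j))"
      by (rule op_mult_finite_support) (use that in \<open>auto simp: \<tau> split: if_splits\<close>)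
    then show ?thesis
      by (simp add: sum_over_Times \<tau>)
  qed
  have summand: "op_mult (UNIV \<times> I) (op_mult (UNIV \<times> I) U \<tau>) (op_adj U) (m, i) (n, i)
      = (\<Sum>a\<in>UNIV. \<Sum>b\<in>UNIV. \<rho> $ a $ b * F a b i)" if "i \<in> I" for i
  proof -
    have "op_mult (UNIV \<times> I) (op_mult (UNIV \<times> I) U \<tau>) (op_adj U) (m, i) (n, i)
      = (\<Sum>r\<in>shell (h $ n + e i). op_mult (UNIV \<times> I) U \<tau> (m, i) r * op_adj U r (n, i))"
    proof (rule op_mult_finite_support)
      fix z assume "z \<in> UNIV \<times> I - shell (h $ n + e i)"
      then have "U (n, i) z = 0"
        using unitary_conserves_energy[of i "snd z" n "fst z"] that
        by (cases z; cases "U (n, i) z = 0") (auto simp: in_shell)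
      then show "op_mult (UNIV \<times> I) U \<tau> (m, i) z = 0 \<or> op_adj U z (n, i) = 0"
        by (simp add: op_adj_def)
    qed (use shell_subset in auto)
    also have "\<dots> = (\<Sum>b\<in>UNIV. \<Sum>j\<in>level (e i + h $ n - h $ b). \<Sum>a\<in>UNIV.
        \<rho> $ a $ b * (complex_of_real (weight (e i + h $ n - h $ b)) * (U (m, i) (a, j) * cnj (U (n, i) (b, j)))))"
      by (simp add: sum_shell left in_level op_adj_def sum_distrib_left sum_distrib_right mult_ac
          add.commute)
    also have "\<dots> = (\<Sum>b\<in>UNIV. \<Sum>a\<in>UNIV. \<rho> $ a $ b * F a b i)"
      unfolding F_def sum_distrib_left by (intro sum.cong refl sum.swap)
    also have "\<dots> = (\<Sum>a\<in>UNIV. \<Sum>b\<in>UNIV. \<rho> $ a $ b * F a b i)"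
      by (rule sum.swap)
    finally show ?thesis .
  qed
  have F: "(F a b has_sum (\<Sum>\<^sub>\<infinity>E. complex_of_real (weight E) * overlap m n a b E)) I" for a b
  proof (rule has_sum_overlap[of m n a b])
    fix s
    assume "((\<lambda>E. complex_of_real (weight E) * overlap m n a b E) has_sum s) UNIV"
    note s = infsumI[OF this]
    assume "((\<lambda>i. complex_of_real (weight (e i + h $ n - h $ b)) *
        (\<Sum>j\<in>level (e i + h $ n - h $ b). U (m, i) (a, j) * cnj (U (n, i) (b, j)))) has_sum s) I"
    then show ?thesis unfolding s F_def[abs_def] .
  qed
  have "((\<lambda>i. op_mult (UNIV \<times> I) (op_mult (UNIV \<times> I) U \<tau>) (op_adj U) (m, i) (n, i)) has_sum
     (\<Sum>a\<in>UNIV. \<Sum>b\<in>UNIV. \<rho> $ a $ b * (\<Sum>\<^sub>\<infinity>E. complex_of_real (weight E) * overlap m n a b E))) I"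
    by (subst has_sum_cong[OF summand])
       (auto intro!: has_sum_finite_sum has_sum_cmult_right F)
  then show ?thesis
    by (simp add: thermal_map_def partial_trace_bath_def \<tau>_def Let_def infsumI)
qed

lemma has_sum_flow:
  "((\<lambda>E. weight E * flow m a E) has_sum (\<Sum>\<^sub>\<infinity>E. weight E * flow m a E)) UNIV"
proof -
  obtain s where "((\<lambda>E. complex_of_real (weight E) * overlap m m a a E) has_sum s) UNIV"
    using has_sum_overlap[of m m a a] by metis
  from has_sum_Re[OF this] show ?thesis
    by (auto simp: overlap_diag has_sum_imp_summable)
qed

end

section \<open>The qutrit\<close>

lemma qutrit_energy_nth [simp]:
  "qutrit_energy w $ 1 = 0" "qutrit_energy w $ 2 = w" "qutrit_energy w $ 3 = 2 * w"
  by (simp_all add: qutrit_energy_def)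

lemma initial_state_nth:
  "initial_state $ a $ b = (if a = 3 \<or> b = 3 then 0 else 1 / 2)"
proof -
  have "complex_of_real (1 / sqrt 2) * complex_of_real (1 / sqrt 2) = 1 / 2"
    by (simp flip: of_real_mult)
  moreover have "a = 1 \<or> a = 2 \<or> a = 3" "b = 1 \<or> b = 2 \<or> b = 3"
    using exhaust_3 by blast+
  ultimately show ?thesis
    by (auto simp: initial_state_def pure_state_def)
qed

locale qutrit_energy_preserving_unitary =
  energy_preserving_unitary \<beta> "qutrit_energy w" I e U
  for \<beta> w :: real and I :: "nat set" and e :: "nat \<Rightarrow> real" and U :: "(3 \<times> nat) op" +
  assumes gap_pos: "w > 0"
begin

text \<open>The probability of passing from level \<open>a\<close> to level \<open>m\<close> when
  the bath starts in its Gibbs state. Indices 1, 2, 3 stand for |0>, |1>, |2>.\<close>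

abbreviation transition :: "3 \<Rightarrow> 3 \<Rightarrow> real" where
  "transition m a \<equiv> \<Sum>\<^sub>\<infinity>E. weight E * flow m a E"

definition coherence :: real where
  "coherence = Re (\<Sum>\<^sub>\<infinity>E. complex_of_real (weight E) * overlap 1 2 1 2 E)"

lemma has_sum_coherence:
  "((\<lambda>E. weight E * Re (overlap 1 2 1 2 E)) has_sum coherence) UNIV"
proof -
  obtain s where s: "((\<lambda>E. complex_of_real (weight E) * overlap 1 2 1 2 E) has_sum s) UNIV"
    using has_sum_overlap[of 1 2 1 2] by metis
  from has_sum_Re[OF s] infsumI[OF s] show ?thesis
    by (simp add: coherence_def)
qed

section \<open>Two upper bounds on the coherence\<close>

lemma Re_overlap_12:
  "Re (overlap 1 2 1 2 E) = (\<Sum>i\<in>level E. \<Sum>j\<in>level E. Re (U (1, i) (1, j) * cnj (U (2, i) (2, j))))"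
  by (simp add: overlap_def)

text \<open>Applies \<open>isometry_block_overlap_bound\<close> to the columns starting in |0>:
  \<open>R2\<close> is the |2>-sector of the shell, at bath energy \<open>E - 2 * w\<close>,
  \<open>K\<close> is its |0>-sector, and \<open>N\<close> is the |1>-block.\<close>

lemma overlap_12_le:
  assumes "\<kappa> > 0"
  shows "Re (overlap 1 2 1 2 E) \<le> real (card (level E)) - flow 3 1 E
     + \<kappa> * (real (card (level (E - 2 * w))) - flow 3 1 E) + real (card (level (E - 2 * w))) / (4 * \<kappa>)"
proof -
  have "(\<Sum>k\<in>{1} \<times> level E. \<Sum>j\<in>level E. Re (U k (1, j) * cnj (U (2, snd k) (2, j))))
     \<le> real (card (level E)) - flow 3 1 E
     + \<kappa> * (real (card ({3::3} \<times> level (E - 2 * w))) - flow 3 1 E)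
     + real (card ({3::3} \<times> level (E - 2 * w))) / (4 * \<kappa>)"
  proof (rule isometry_block_overlap_bound[where R = "shell E"])
    show "(\<Sum>r\<in>shell E. cnj (U r (1, j)) * U r (1, j')) = (if j = j' then 1 else 0)"
      if "j \<in> level E" "j' \<in> level E" for j j'
      using unitary_columns[of j E 1 j'] that by simp
    show "(\<Sum>j\<in>level E. (cmod (U r (1, j)))\<^sup>2) \<le> 1" if "r \<in> {3} \<times> level (E - 2 * w)" for r
      using unitary_row_norm[of "snd r" "fst r" 1 E] that by (cases r) (auto simp: in_level)
    \<comment> \<open>The |1>-block is part of an isometry into the shell of energy
      \<open>E + w\<close>, hence a contraction.\<close>
    show "(\<Sum>k\<in>{1::3} \<times> level E. (cmod (\<Sum>j\<in>level E. U (2, snd k) (2, j) * v j))\<^sup>2)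
        \<le> (\<Sum>j\<in>level E. (cmod (v j))\<^sup>2)" for v
    proof -
      have "(\<Sum>k\<in>{1::3} \<times> level E. (cmod (\<Sum>j\<in>level E. U (2, snd k) (2, j) * v j))\<^sup>2)
          = (\<Sum>k\<in>{2} \<times> level E. (cmod (\<Sum>j\<in>level E. U k (2, j) * v j))\<^sup>2)"
        by (simp add: sum_over_Times)
      also have "\<dots> \<le> (\<Sum>k\<in>shell (E + w). (cmod (\<Sum>j\<in>level E. U k (2, j) * v j))\<^sup>2)"
        by (rule sum_mono2) (auto simp: in_shell in_level)
      also have "\<dots> = (\<Sum>j\<in>level E. (cmod (v j))\<^sup>2)"
        by (rule isometry_norm) (use unitary_columns[of _ "E + w" 2] in auto)
      finally show ?thesis .
    qed
    show "flow 3 1 E = (\<Sum>r\<in>{3} \<times> level (E - 2 * w). \<Sum>j\<in>level E. (cmod (U r (1, j)))\<^sup>2)"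
      by (simp add: flow_def sum_over_Times)
  qed (use assms in \<open>auto simp: in_shell in_level\<close>)
  then show ?thesis
    by (simp add: Re_overlap_12 sum_over_Times card_cartesian_product)
qed

text \<open>Cauchy-Schwarz in a form that is linear in the flows for fixed \<open>l\<close>, so that
  it passes to Gibbs averages.\<close>

lemma overlap_12_le_mean:
  assumes "l > 0"
  shows "2 * Re (overlap 1 2 1 2 E) \<le> flow 1 1 E / l + l * flow 2 2 E"
proof -
  have "Re (overlap 1 2 1 2 E) \<le> (\<Sum>i\<in>level E. \<Sum>j\<in>level E. (1 / (2 * l)) * (cmod (U (1, i) (1, j)))\<^sup>2
      + (cmod (U (2, i) (2, j)))\<^sup>2 / (4 * (1 / (2 * l))))"
    unfolding Re_overlap_12 by (intro sum_mono Re_mult_cnj_le) (use assms in simp)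
  also have "\<dots> = flow 1 1 E / (2 * l) + l * flow 2 2 E / 2"
    by (simp add: flow_def sum.distrib sum_distrib_left sum_divide_distrib mult_ac)
  finally show ?thesis by (simp add: field_simps)
qed

lemma coherence_le:
  assumes "\<kappa> > 0" "q = exp (- \<beta> * w)"
  shows "coherence \<le> 1 - transition 3 1 + \<kappa> * (q\<^sup>2 - transition 3 1) + q\<^sup>2 / (4 * \<kappa>)"
proof (rule has_sum_mono[OF has_sum_coherence])
  have q: "exp (- \<beta> * (2 * w)) = q\<^sup>2"
    by (simp add: assms power2_eq_square flip: exp_add)
  \<comment> \<open>The degeneracy of \<open>E\<close> averages to 1 and that of
    \<open>E - 2 * w\<close> to \<open>q\<^sup>2\<close>.\<close>
  note hs = has_sum_add[OF has_sum_add[OF has_sum_add[OF has_sum_weight_card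
        has_sum_cmult_right[OF has_sum_flow[of 3 1], of "- (1 + \<kappa>)"]]
        has_sum_cmult_right[OF has_sum_weight_card_shift[of "2 * w"], of \<kappa>]]
        has_sum_cmult_right[OF has_sum_weight_card_shift[of "2 * w"], of "1 / (4 * \<kappa>)"], unfolded q]
  show "((\<lambda>E. weight E * (real (card (level E)) - flow 3 1 E
     + \<kappa> * (real (card (level (E - 2 * w))) - flow 3 1 E) + real (card (level (E - 2 * w))) / (4 * \<kappa>)))
     has_sum (1 - transition 3 1 + \<kappa> * (q\<^sup>2 - transition 3 1) + q\<^sup>2 / (4 * \<kappa>))) UNIV"
    using hs by (simp add: algebra_simps)
qed (use overlap_12_le[OF assms(1)] in \<open>intro mult_left_mono weight_nonneg\<close>)

lemma coherence_le_mean: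
  assumes "l > 0"
  shows "2 * coherence \<le> transition 1 1 / l + l * transition 2 2"
proof (rule has_sum_mono)
  show "((\<lambda>E. 2 * (weight E * Re (overlap 1 2 1 2 E))) has_sum 2 * coherence) UNIV"
    by (intro has_sum_cmult_right has_sum_coherence)
  show "((\<lambda>E. weight E * flow 1 1 E / l + l * (weight E * flow 2 2 E)) has_sum
      (transition 1 1 / l + l * transition 2 2)) UNIV"
    by (intro has_sum_add has_sum_cmult_right has_sum_divide_const has_sum_flow)
  show "2 * (weight E * Re (overlap 1 2 1 2 E)) \<le> weight E * flow 1 1 E / l + l * (weight E * flow 2 2 E)" for E
    using mult_left_mono[OF overlap_12_le_mean[OF assms, of E] weight_nonneg[of E]]
    by (simp add: algebra_simps)
qed

lemma transition_nonneg: "transition m a \<ge> 0"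
  by (rule has_sum_nonneg[OF has_sum_flow]) (simp add: weight_nonneg flow_nonneg)

lemma transition_2_le: "transition 2 2 + transition 3 2 \<le> 1"
proof (rule has_sum_mono[OF has_sum_add[OF has_sum_flow has_sum_flow] has_sum_weight_card])
  fix E
  have "flow 2 2 E + flow 3 2 E \<le> real (card (level E))"
    using sum_flow[of 2 E] flow_nonneg[of 1 2 E] by (simp add: sum_3)
  from mult_left_mono[OF this weight_nonneg]
  show "weight E * flow 2 2 E + weight E * flow 3 2 E \<le> weight E * real (card (level E))"
    by (simp add: algebra_simps)
qed

section \<open>Entries of the output state\<close>

lemma infsum_overlap_diag:
  "(\<Sum>\<^sub>\<infinity>E. complex_of_real (weight E) * overlap m m a a E) = complex_of_real (transition m a)"
  using has_sum_of_real[OF has_sum_flow[of m a], where 'a = complex]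
  by (simp add: overlap_diag infsumI)

lemma thermal_map_initial_state_diag:
  "Re (thermal_map \<beta> I e U initial_state $ m $ m) = (transition m 1 + transition m 2) / 2"
proof -
  have "overlap m m 1 2 E = 0" "overlap m m 2 1 E = 0" for E
    using gap_pos by (auto intro!: overlap_eq_0)
  then show ?thesis
    by (simp add: thermal_map_entry sum_3 initial_state_nth infsum_overlap_diag field_simps)
qed

text \<open>Among the nonzero input entries only (1, 2), of value 1/2, has the matching energy
  gap.\<close>

lemma thermal_map_initial_state_coherence:
  "Re (thermal_map \<beta> I e U initial_state $ 1 $ 2) = coherence / 2"
proof -
  have "overlap 1 2 1 1 E = 0" "overlap 1 2 2 2 E = 0" "overlap 1 2 2 1 E = 0" for E
    using gap_pos by (auto intro!: overlap_eq_0)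
  then show ?thesis
    by (simp add: thermal_map_entry sum_3 initial_state_nth coherence_def)
qed

end

section \<open>Contradiction near the target state\<close>

lemma target_state_nth:
  assumes "q = exp (- \<beta> * w)"
  shows "target_state \<beta> w $ 1 $ 1 = complex_of_real ((1 - q\<^sup>2) / 2)"
    "target_state \<beta> w $ 1 $ 2 = complex_of_real (sqrt (1 - q\<^sup>2) / 2)"
    "target_state \<beta> w $ 3 $ 3 = complex_of_real (q\<^sup>2 / 2)"
proof -
  have q: "exp (- 2 * \<beta> * w) = q\<^sup>2"
    by (simp add: assms power2_eq_square flip: exp_add)
  show "target_state \<beta> w $ 1 $ 1 = complex_of_real ((1 - q\<^sup>2) / 2)"
    "target_state \<beta> w $ 1 $ 2 = complex_of_real (sqrt (1 - q\<^sup>2) / 2)"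
    "target_state \<beta> w $ 3 $ 3 = complex_of_real (q\<^sup>2 / 2)"
    unfolding target_state_def Let_def q vector_scaleR_component
    by (simp_all add: scaleR_conv_of_real)
qed

lemma abs_Re_entry_le_dist:
  "\<bar>Re (A $ m $ n) - Re (B $ m $ n)\<bar> \<le> dist (A::complex^'n^'m) B"
proof -
  have "\<bar>Re (A $ m $ n) - Re (B $ m $ n)\<bar> \<le> norm (A $ m $ n - B $ m $ n)"
    using abs_Re_le_cmod[of "A $ m $ n - B $ m $ n"] by simp
  also have "\<dots> = norm ((A - B) $ m $ n)" by simp
  also have "\<dots> \<le> norm ((A - B) $ m)" by (rule Finite_Cartesian_Product.norm_nth_le)
  also have "\<dots> \<le> norm (A - B)" by (rule Finite_Cartesian_Product.norm_nth_le)
  finally show ?thesis by (simp add: dist_norm)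
qed

text \<open>Read \<open>p31\<close> as \<open>transition 3 1\<close> and so on, and \<open>C\<close>
  as \<open>coherence\<close>. By \<open>mean\<close>, \<open>p22\<close> is nearly at least 1, so
  \<open>p32\<close> is nearly at most 0 and \<open>p31\<close> nearly at least
  \<open>q\<^sup>2\<close>. Then \<open>bound\<close> contradicts the required size of
  \<open>C\<close>.\<close>

lemma coherence_contradiction:
  fixes c q \<epsilon> C p11 p12 p22 p31 p32 :: real
  assumes c: "0 < c" "c \<le> q" "c \<le> 1 - q - q\<^sup>2" and \<epsilon>: "\<epsilon> = c ^ 5 / 100"
    and nonneg: "0 \<le> p12"
    and C: "C \<ge> sqrt (1 - q\<^sup>2) - 2 * \<epsilon>"
    and rho: "p11 + p12 \<le> 1 - q\<^sup>2 + 2 * \<epsilon>" "p31 + p32 \<ge> q\<^sup>2 - 2 * \<epsilon>"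
    and col: "p22 + p32 \<le> 1"
    and mean: "\<And>l. l > 0 \<Longrightarrow> 2 * C \<le> p11 / l + l * p22"
    and bound: "\<And>\<kappa>. \<kappa> > 0 \<Longrightarrow> C \<le> 1 - p31 + \<kappa> * (q\<^sup>2 - p31) + q\<^sup>2 / (4 * \<kappa>)"
  shows False
proof -
  \<comment> \<open>The weight for which \<open>mean\<close> is tight at
    \<open>p11 = 1 - q\<^sup>2\<close> and \<open>p22 = 1\<close>.\<close>
  define l where "l = sqrt (1 - q\<^sup>2)"
  have q: "0 < q" "q < 1" "c < 1" using c by (auto intro: order_less_le_trans) (smt (verit) zero_le_power2)+
  have l2: "l\<^sup>2 = 1 - q\<^sup>2" using q by (simp add: l_def power_le_one)
  have l2c: "c \<le> l\<^sup>2" using l2 c q by linarith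
  have l: "0 < l" "l \<le> 1" using l2c c(1) q by (auto simp: l_def power_le_one abs_square_less_1)
  have lc: "c \<le> l" using l2c mult_left_mono[of l 1 l] l unfolding power2_eq_square by linarith
  have \<epsilon>0: "\<epsilon> > 0" using c by (simp add: \<epsilon>)
  have "2 * (l - 2 * \<epsilon>) \<le> 2 * C" using C by (simp add: l_def)
  also have "\<dots> \<le> p11 / l + l * p22" by (rule mean[OF l(1)])
  also have "\<dots> \<le> (l\<^sup>2 + 2 * \<epsilon>) / l + l * p22"
    using rho(1) nonneg l by (intro add_right_mono divide_right_mono) (auto simp: l2)
  finally have "2 * (l - 2 * \<epsilon>) * l \<le> ((l\<^sup>2 + 2 * \<epsilon>) / l + l * p22) * l"
    using l by (intro mult_right_mono) auto
  also have "\<dots> = l\<^sup>2 + 2 * \<epsilon> + l\<^sup>2 * p22"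
    using l by (simp add: field_simps power2_eq_square)
  finally have "l\<^sup>2 * (1 - p22) \<le> 2 * \<epsilon> + 4 * (\<epsilon> * l)"
    by (simp add: algebra_simps power2_eq_square)
  also have "\<dots> \<le> 6 * \<epsilon>" using l \<epsilon>0 mult_left_le[of l \<epsilon>] by simp
  finally have p22: "l\<^sup>2 * (1 - p22) \<le> 6 * \<epsilon>" .
  have "c * (1 - p22) \<le> 6 * \<epsilon>"
  \<comment> \<open>Lowering the factor \<open>l\<^sup>2\<close> to \<open>c\<close> is monotone
    only for nonnegative \<open>1 - p22\<close>.\<close>
  proof (cases "p22 \<le> 1")
    case True
    then have "c * (1 - p22) \<le> l\<^sup>2 * (1 - p22)" using l2c by (intro mult_right_mono) auto
    with p22 show ?thesis by linarith
  next
    case False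
    then have "c * (1 - p22) \<le> 0" using c by (simp add: mult_le_0_iff)
    with \<epsilon>0 show ?thesis by linarith
  qed
  moreover have "c * p32 \<le> c * (1 - p22)" using col c by (intro mult_left_mono) auto
  moreover have "c * (q\<^sup>2 - p31) \<le> c * (p32 + 2 * \<epsilon>)" using rho(2) c by (intro mult_left_mono) auto
  moreover have "c * \<epsilon> \<le> \<epsilon>" using q \<epsilon>0 by simp
  ultimately have p31: "c * (q\<^sup>2 - p31) \<le> 8 * \<epsilon>" by (simp add: algebra_simps)
  \<comment> \<open>The weight \<open>1 / c\<close> makes the last fraction
    \<open>c * q\<^sup>2 / 4\<close>, half of the gap \<open>q\<^sup>2 * c / 2\<close> found below,
    and enlarges the deficit \<open>q\<^sup>2 - p31\<close> only by a factor
    \<open>1 / c\<close>.\<close>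
  have "l \<le> l\<^sup>2 + (q\<^sup>2 - p31) + (1 / c) * (q\<^sup>2 - p31) + q\<^sup>2 / (4 * (1 / c)) + 2 * \<epsilon>"
    using bound[of "1 / c"] C c(1) l2 unfolding l_def[symmetric] by simp
  then have "c\<^sup>2 * l \<le> c\<^sup>2 * (l\<^sup>2 + (q\<^sup>2 - p31) + (1 / c) * (q\<^sup>2 - p31) + q\<^sup>2 / (4 * (1 / c)) + 2 * \<epsilon>)"
    by (intro mult_left_mono) auto
  also have "\<dots> = c\<^sup>2 * l\<^sup>2 + c * (c * (q\<^sup>2 - p31)) + c * (q\<^sup>2 - p31) + c ^ 3 * q\<^sup>2 / 4 + 2 * c\<^sup>2 * \<epsilon>"
    using c(1) by (simp add: field_simps eval_nat_numeral)
  also have "\<dots> \<le> c\<^sup>2 * l\<^sup>2 + 8 * \<epsilon> + 8 * \<epsilon> + c ^ 3 * q\<^sup>2 / 4 + 2 * \<epsilon>"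
  proof -
    have "c * (c * (q\<^sup>2 - p31)) \<le> c * (8 * \<epsilon>)" using p31 c by (intro mult_left_mono) auto
    also have "\<dots> \<le> 8 * \<epsilon>" using q \<epsilon>0 by simp
    finally have 1: "c * (c * (q\<^sup>2 - p31)) \<le> 8 * \<epsilon>" .
    have "c\<^sup>2 * \<epsilon> \<le> \<epsilon>" using q c \<epsilon>0 by (simp add: power_le_one)
    with 1 p31 show ?thesis by linarith
  qed
  finally have main: "c\<^sup>2 * (l - l\<^sup>2) \<le> 18 * \<epsilon> + c ^ 3 * q\<^sup>2 / 4"
    by (simp add: algebra_simps)
  \<comment> \<open>The gap is \<open>l * (1 - l)\<close>, with \<open>l\<close> at least
    \<open>c\<close> and \<open>1 - l\<close> at least \<open>q\<^sup>2 / 2\<close>.\<close>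
  have "q\<^sup>2 * c / 2 \<le> l - l\<^sup>2"
  proof -
    have "q\<^sup>2 = (1 - l) * (1 + l)" using l2 by (simp add: algebra_simps power2_eq_square)
    also have "\<dots> \<le> (1 - l) * 2" using l by (intro mult_left_mono) auto
    finally have "q\<^sup>2 / 2 * c \<le> (1 - l) * l" using lc c l by (intro mult_mono) auto
    then show ?thesis by (simp add: algebra_simps power2_eq_square)
  qed
  then have "c\<^sup>2 * (q\<^sup>2 * c / 2) \<le> c\<^sup>2 * (l - l\<^sup>2)" by (intro mult_left_mono) auto
  with main have "c ^ 3 * q\<^sup>2 / 4 \<le> 18 * \<epsilon>" by (simp add: eval_nat_numeral algebra_simps)
  moreover have "c ^ 3 * c\<^sup>2 \<le> c ^ 3 * q\<^sup>2" using c by (intro mult_left_mono power_mono) auto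
  \<comment> \<open>A quarter of this is \<open>25 * \<epsilon>\<close>, which exceeds the allowed
    \<open>18 * \<epsilon>\<close>; hence the form of \<epsilon>.\<close>
  moreover have "c ^ 3 * c\<^sup>2 = 100 * \<epsilon>" by (simp add: \<epsilon> flip: power_add)
  ultimately show False using \<epsilon>0 by linarith
qed

text \<open>The Euclidean distance bounds every entry. The output entries are half the transition
  sums and half the coherence, which doubles the tolerance.\<close>

lemma target_state_not_thermal:
  assumes c: "0 < c" "c \<le> exp (- \<beta> * w)" "c \<le> 1 - exp (- \<beta> * w) - exp (- \<beta> * w) ^ 2"
    and "w > 0" "heat_bath \<beta> I e"
    and dist: "dist \<rho>' (target_state \<beta> w) \<le> c ^ 5 / 100"
  shows "\<not> (\<exists>\<E>. thermal_operation \<beta> (qutrit_energy w) I e \<E> \<and> \<E> initial_state = \<rho>')"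
proof
  assume "\<exists>\<E>. thermal_operation \<beta> (qutrit_energy w) I e \<E> \<and> \<E> initial_state = \<rho>'"
  then obtain U where U: "op_unitary (UNIV \<times> I) U" "op_commute (UNIV \<times> I) U (total_ham (qutrit_energy w) e)"
    and \<rho>': "thermal_map \<beta> I e U initial_state = \<rho>'"
    by (auto simp: thermal_operation_def)
  interpret qutrit_energy_preserving_unitary \<beta> w I e U
    by unfold_locales (use assms U in auto)
  define q where "q = exp (- \<beta> * w)"
  have close: "\<bar>Re (\<rho>' $ m $ n) - Re (target_state \<beta> w $ m $ n)\<bar> \<le> c ^ 5 / 100" for m n
    using abs_Re_entry_le_dist[of \<rho>' m n "target_state \<beta> w"] dist by linarith
  note target = target_state_nth[OF q_def]
  show False
  proof (rule coherence_contradiction[OF c(1), of q "c ^ 5 / 100" "transition 1 2" coherence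
        "transition 1 1" "transition 3 1" "transition 3 2" "transition 2 2"])
    show "sqrt (1 - q\<^sup>2) - 2 * (c ^ 5 / 100) \<le> coherence"
      using close[of 1 2] thermal_map_initial_state_coherence unfolding \<rho>' target Re_complex_of_real
      by linarith
    show "transition 1 1 + transition 1 2 \<le> 1 - q\<^sup>2 + 2 * (c ^ 5 / 100)"
      using abs_le_D1[OF close[of 1 1]] thermal_map_initial_state_diag[of 1]
      unfolding \<rho>' target Re_complex_of_real by (simp add: field_simps)
    show "transition 3 1 + transition 3 2 \<ge> q\<^sup>2 - 2 * (c ^ 5 / 100)"
      using abs_le_D2[OF close[of 3 3]] thermal_map_initial_state_diag[of 3]
      unfolding \<rho>' target Re_complex_of_real by (simp add: field_simps)
  qed (use c coherence_le[OF _ q_def] coherence_le_mean transition_2_le transition_nonneg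
      in \<open>auto simp: q_def\<close>)
qed

text \<open>A common lower bound \<open>c\<close> for \<open>q\<close> and
  \<open>1 - q - q\<^sup>2\<close> expresses that neither is small; the tolerances depend on
  \<open>c\<close> alone.\<close>

theorem mainTheorem1:
  shows "(\<forall>\<beta> w :: real. \<beta> > 0 \<longrightarrow> w > 0 \<longrightarrow>
            (\<exists>\<E>. enhanced_thermal_operation \<beta> (qutrit_energy w) \<E> \<and>
                 \<E> initial_state = target_state \<beta> w))
       \<and> (\<forall>c > 0 :: real. \<exists>\<epsilon> > 0. \<exists>\<delta>\<^sub>0 > 0. \<forall>\<beta> w :: real.
            \<beta> > 0 \<longrightarrow> w > 0 \<longrightarrow>
            c \<le> exp (- \<beta> * w) \<longrightarrow> c \<le> 1 - exp (- \<beta> * w) - exp (- \<beta> * w) ^ 2 \<longrightarrow>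
            (\<forall>\<delta> I e. 0 \<le> \<delta> \<longrightarrow> \<delta> \<le> \<delta>\<^sub>0 \<longrightarrow> large_heat_bath \<beta> w \<delta> I e \<longrightarrow>
               (\<forall>\<rho>'. density_matrix \<rho>' \<longrightarrow> dist \<rho>' (target_state \<beta> w) \<le> \<epsilon> \<longrightarrow>
                  \<not> (\<exists>\<E>. thermal_operation \<beta> (qutrit_energy w) I e \<E> \<and>
                         \<E> initial_state = \<rho>'))))"
proof (intro conjI allI impI)
  fix \<beta> w :: real
  assume "\<beta> > 0" "w > 0"
  then show "\<exists>\<E>. enhanced_thermal_operation \<beta> (qutrit_energy w) \<E> \<and> \<E> initial_state = target_state \<beta> w"
    by (rule target_state_enhanced_thermal)
next
  fix c :: real
  assume "c > 0"
  then show "\<exists>\<epsilon> > 0. \<exists>\<delta>\<^sub>0 > 0. \<forall>\<beta> w :: real.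
            \<beta> > 0 \<longrightarrow> w > 0 \<longrightarrow>
            c \<le> exp (- \<beta> * w) \<longrightarrow> c \<le> 1 - exp (- \<beta> * w) - exp (- \<beta> * w) ^ 2 \<longrightarrow>
            (\<forall>\<delta> I e. 0 \<le> \<delta> \<longrightarrow> \<delta> \<le> \<delta>\<^sub>0 \<longrightarrow> large_heat_bath \<beta> w \<delta> I e \<longrightarrow>
               (\<forall>\<rho>'. density_matrix \<rho>' \<longrightarrow> dist \<rho>' (target_state \<beta> w) \<le> \<epsilon> \<longrightarrow>
                  \<not> (\<exists>\<E>. thermal_operation \<beta> (qutrit_energy w) I e \<E> \<and>
                         \<E> initial_state = \<rho>')))"
    by (intro exI[of _ "c ^ 5 / 100"] exI[of _ 1] conjI allI impI target_state_not_thermal[of c])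
      (auto simp: large_heat_bath_def)
qed

end
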